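(* Consider a serial inventory network with $K\ge1$ locations as in the context. For any echelon base-stock levels $\hat S^1,\dots,\hat S^K\in\mathbb R$, the echelon-stock policy $$a_t^{(0,1)}=[\hat S^1-Y_t^1]^+,\qquad a_t^{(k-1,k)}=\min\{I_t^{k-1},[\hat S^k-Y_t^k]^+\}\quad(k=2,\dots,K)$$ can be represented by the GNN architecture described in the context with $K-1$ rounds of message passing; i.e. there exist choices of the functions EmbedNode, EmbedEdge, UpdateNode, UpdateEdge and Readout such that the GNN with $K-1$ message-passing rounds outputs exactly these allocations at every state.
   Context: **Serial network.** Nodes $0,1,\dots,K$ with directed edges $(k-1,k)$, $k=1,\dots,K$; node $0$ is an external supplier with unlimited stock, node $K$ is the only store (facing demand, with unmet demand backlogged, so $I_t^K$ may be negative), and nodes $1,\dots,K-1$ hold nonnegative inventory and supply the next node. Node $k\ge1$ has on-hand inventory $I_t^k$ and a vector $Q_t^k\in\mathbb R_+^{L^k-1}$ of outstanding orders, where $L^k$ is the lead time of edge $(k-1,k)$. The inventory position is $X_t^k=I_t^k+\sum_{l=1}^{L^k-1}Q_t^k(l)$, and the echelon inventory position is $Y_t^k=\sum_{j=k}^KX_t^j$. A feasible allocation satisfies $a_t^{(k-1,k)}\ge0$ and, for $k\ge2$, $a_t^{(k-1,k)}\le I_t^{k-1}$. **GNN architecture.** For a node $k$ let $\mathcal N^k_{\rm sup}$ and $\mathcal N^k_{\rm rec}$ be its sets of in- and out-neighbours. Node $k\ge 1$ has feature vector $S_t^k$ containing $I_t^k$, $Q_t^k$ and its echelon base-stock level $\hat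 S^k$ (padded to common dimension); node $0$ has a fixed feature vector; each edge has its lead time $L^{(j,k)}$ as feature. For functions EmbedNode, EmbedEdge, UpdateNode, UpdateEdge (with values in finite-dimensional Euclidean spaces) and Readout (real-valued), each shared across all nodes or edges, the GNN with $R$ rounds computes: (i) $h^k\leftarrow\mathrm{EmbedNode}(S_t^k)$ for all nodes; $h^{(j,k)}\leftarrow\mathrm{EmbedEdge}(h^j,h^k,L^{(j,k)})$ for all edges. (ii) Repeat $R$ times: for each node $k\ge1$, $z_{\rm in}^k=\sum_{j\in\mathcal N^k_{\rm sup}}h^{(j,k)}/\sqrt{|\mathcal N^k_{\rm sup}|}$, $z_{\rm out}^k=\sum_{j\in\mathcal N^k_{\rm rec}}h^{(k,j)}/\sqrt{|\mathcal N^k_{\rm rec}|}$ (empty sum gives $0$), $h^k\leftarrow h^k+\mathrm{UpdateNode}(h^k,z_{\rm in}^k,z_{\rm out}^k)$; then for each edge $h^{(j,k)}\leftarrow h^{(j,k)}+\mathrm{UpdateEdge}(h^{(j,k)},h^j,h^k)$. (iii) $b^{(j,k)}\leftarrow\mathrm{Readout}(h^{(j,k)})$ for each edge. (iv) $a^{(0,1)}=b^{(0,1)}$, and for every node $j\in\{1,\dots,K-1\}$ the Proportional Allocation rule is applied: $a^{(j,k)}=[b^{(j,k)}]^+\min\{1,I_t^j/\sum_{i\in\mathcal N_{\rm rec}^j}[b^{(j,i)}]^+\}$ (equal to $0$ if $[b^{(j,k)}]^+=0$). *)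

theory Defs
  imports Complex_Main "Jordan_Normal_Form.Matrix"
begin

text \<open>Serial network: nodes \<open>0..K\<close>; node \<open>0\<close> is the external supplier and \<open>L k\<close> is
  the lead time of edge \<open>(k - 1, k)\<close>. A state is a pair \<open>I\<close>, \<open>Q\<close>, where \<open>Q k l\<close> is the
  entry \<open>l \<in> {1..<L k}\<close> of the outstanding-order vector of node \<open>k\<close>; the values at
  node \<open>0\<close> and outside these index ranges are never read.\<close>

definition serial_edges :: "nat \<Rightarrow> (nat \<times> nat) set" where
  "serial_edges K = {(k - 1, k) | k. k \<in> {1..K}}"

definition network_state ::
  "nat \<Rightarrow> (nat \<Rightarrow> nat) \<Rightarrow> (nat \<Rightarrow> real) \<Rightarrow> (nat \<Rightarrow> nat \<Rightarrow> real) \<Rightarrow> bool" where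
  "network_state K L I Q \<longleftrightarrow>
     (\<forall>k\<in>{1..<K}. 0 \<le> I k) \<and> (\<forall>k\<in>{1..K}. \<forall>l\<in>{1..<L k}. 0 \<le> Q k l)"

definition inventory_position ::
  "(nat \<Rightarrow> nat) \<Rightarrow> (nat \<Rightarrow> real) \<Rightarrow> (nat \<Rightarrow> nat \<Rightarrow> real) \<Rightarrow> nat \<Rightarrow> real" where
  "inventory_position L I Q k = I k + (\<Sum>l\<in>{1..<L k}. Q k l)"

definition echelon_position ::
  "nat \<Rightarrow> (nat \<Rightarrow> nat) \<Rightarrow> (nat \<Rightarrow> real) \<Rightarrow> (nat \<Rightarrow> nat \<Rightarrow> real) \<Rightarrow> nat \<Rightarrow> real" where
  "echelon_position K L I Q k = (\<Sum>j\<in>{k..K}. inventory_position L I Q j)"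

definition pos_part :: "real \<Rightarrow> real" where
  "pos_part x = max x 0"

text \<open>Allocation on edge \<open>(k - 1, k)\<close>, for \<open>k \<in> {1..K}\<close>.\<close>

definition echelon_stock_policy ::
  "nat \<Rightarrow> (nat \<Rightarrow> nat) \<Rightarrow> (nat \<Rightarrow> real) \<Rightarrow> (nat \<Rightarrow> real) \<Rightarrow> (nat \<Rightarrow> nat \<Rightarrow> real) \<Rightarrow> nat \<Rightarrow> real" where
  "echelon_stock_policy K L S I Q k =
     (if k = 1 then pos_part (S 1 - echelon_position K L I Q 1)
      else min (I (k - 1)) (pos_part (S k - echelon_position K L I Q k)))"

text \<open>Feature vectors have dimension \<open>m + 2\<close>, where \<open>m\<close> bounds the length of every
  outstanding-order vector: entry \<open>0\<close> is the on-hand inventory, entries \<open>1..m\<close> are the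
  outstanding orders padded by zeros, entry \<open>m + 1\<close> is the echelon base-stock level.
  Node \<open>0\<close> has the fixed feature vector \<open>s0\<close>.\<close>

definition node_feature ::
  "nat \<Rightarrow> (nat \<Rightarrow> nat) \<Rightarrow> real vec \<Rightarrow> (nat \<Rightarrow> real) \<Rightarrow> (nat \<Rightarrow> real) \<Rightarrow> (nat \<Rightarrow> nat \<Rightarrow> real)
     \<Rightarrow> nat \<Rightarrow> real vec" where
  "node_feature m L s0 S I Q k =
     (if k = 0 then s0
      else vec (m + 2) (\<lambda>i. if i = 0 then I k
                            else if i = m + 1 then S k
                            else if i < L k then Q k i
                            else 0))"

definition sup_nbrs :: "(nat \<times> nat) set \<Rightarrow> nat \<Rightarrow> nat set" where
  "sup_nbrs E k = {j. (j, k) \<in> E}"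

definition rec_nbrs :: "(nat \<times> nat) set \<Rightarrow> nat \<Rightarrow> nat set" where
  "rec_nbrs E k = {j. (k, j) \<in> E}"

text \<open>The dimensions of the embedding spaces are part of the choice of a GNN, so vectors are
  of type \<open>real vec\<close>, and \<open>is_gnn\<close> fixes the domains and codomains.\<close>

record gnn =
  node_dim :: nat
  edge_dim :: nat
  embed_node :: "real vec \<Rightarrow> real vec"
  embed_edge :: "real vec \<Rightarrow> real vec \<Rightarrow> real \<Rightarrow> real vec"
  update_node :: "real vec \<Rightarrow> real vec \<Rightarrow> real vec \<Rightarrow> real vec"
  update_edge :: "real vec \<Rightarrow> real vec \<Rightarrow> real vec \<Rightarrow> real vec"
  readout :: "real vec \<Rightarrow> real"

definition is_gnn :: "nat \<Rightarrow> gnn \<Rightarrow> bool" where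
  "is_gnn d G \<longleftrightarrow>
     (let N = carrier_vec (node_dim G); M = carrier_vec (edge_dim G) in
        (\<forall>s \<in> carrier_vec d. embed_node G s \<in> N) \<and>
        (\<forall>x\<in>N. \<forall>y\<in>N. \<forall>l. embed_edge G x y l \<in> M) \<and>
        (\<forall>x\<in>N. \<forall>u\<in>M. \<forall>v\<in>M. update_node G x u v \<in> N) \<and>
        (\<forall>u\<in>M. \<forall>x\<in>N. \<forall>y\<in>N. update_edge G u x y \<in> M))"

type_synonym embeddings = "(nat \<Rightarrow> real vec) \<times> (nat \<times> nat \<Rightarrow> real vec)"

definition gnn_init ::
  "gnn \<Rightarrow> (nat \<Rightarrow> real vec) \<Rightarrow> (nat \<times> nat \<Rightarrow> real) \<Rightarrow> embeddings" where
  "gnn_init G feat lead =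
     (let hn = (\<lambda>k. embed_node G (feat k))
      in (hn, \<lambda>(j, k). embed_edge G (hn j) (hn k) (lead (j, k))))"

text \<open>An empty neighbourhood yields the zero vector, since \<open>0 / 0 = 0\<close>.\<close>

definition z_in :: "gnn \<Rightarrow> (nat \<times> nat) set \<Rightarrow> (nat \<times> nat \<Rightarrow> real vec) \<Rightarrow> nat \<Rightarrow> real vec" where
  "z_in G E he k =
     vec (edge_dim G) (\<lambda>i. (\<Sum>j\<in>sup_nbrs E k. he (j, k) $ i) / sqrt (real (card (sup_nbrs E k))))"

definition z_out :: "gnn \<Rightarrow> (nat \<times> nat) set \<Rightarrow> (nat \<times> nat \<Rightarrow> real vec) \<Rightarrow> nat \<Rightarrow> real vec" where
  "z_out G E he k =
     vec (edge_dim G) (\<lambda>i. (\<Sum>j\<in>rec_nbrs E k. he (k, j) $ i) / sqrt (real (card (rec_nbrs E k))))"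

text \<open>Edge updates use the node embeddings already updated in the same round.\<close>

definition gnn_round :: "gnn \<Rightarrow> (nat \<times> nat) set \<Rightarrow> embeddings \<Rightarrow> embeddings" where
  "gnn_round G E = (\<lambda>(hn, he).
     let hn' = (\<lambda>k. if k = 0 then hn 0
                    else hn k + update_node G (hn k) (z_in G E he k) (z_out G E he k));
         he' = (\<lambda>(j, k). he (j, k) + update_edge G (he (j, k)) (hn' j) (hn' k))
     in (hn', he'))"

definition gnn_readout ::
  "gnn \<Rightarrow> (nat \<times> nat) set \<Rightarrow> nat \<Rightarrow> (nat \<Rightarrow> real vec) \<Rightarrow> (nat \<times> nat \<Rightarrow> real)
     \<Rightarrow> nat \<times> nat \<Rightarrow> real" where
  "gnn_readout G E R feat lead e =
     readout G (snd ((gnn_round G E ^^ R) (gnn_init G feat lead)) e)"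

definition proportional_allocation ::
  "(nat \<times> nat) set \<Rightarrow> (nat \<Rightarrow> real) \<Rightarrow> (nat \<times> nat \<Rightarrow> real) \<Rightarrow> nat \<Rightarrow> nat \<Rightarrow> real" where
  "proportional_allocation E I b j k =
     (if pos_part (b (j, k)) = 0 then 0
      else pos_part (b (j, k)) * min 1 (I j / (\<Sum>i\<in>rec_nbrs E j. pos_part (b (j, i)))))"

definition gnn_allocation ::
  "gnn \<Rightarrow> (nat \<times> nat) set \<Rightarrow> nat \<Rightarrow> (nat \<Rightarrow> real vec) \<Rightarrow> (nat \<times> nat \<Rightarrow> real)
     \<Rightarrow> (nat \<Rightarrow> real) \<Rightarrow> nat \<Rightarrow> nat \<Rightarrow> real" where
  "gnn_allocation G E R feat lead I j k =
     (let b = gnn_readout G E R feat lead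
      in if j = 0 then b (j, k) else proportional_allocation E I b j k)"

end

(* Every edge (k - 1, k) carries a window sum of the inventory positions of the nodes k, k + 1, ...
   One round of message passing hands the window of edge (k, k + 1) to node k, which adds its own
   inventory position and passes the result to edge (k - 1, k); so each round extends all windows
   by one node, and K - 1 rounds suffice to reach the store K from node 1. The readout
   [S k - Y k]^+ is then exactly the echelon-stock order, and proportional allocation to a single
   receiver truncates it at the on-hand inventory. *)
theory Submission
  imports Defs
begin

text \<open>The truncation by \<open>min\<close> lets a window stop growing once it reaches the
  store, so later rounds leave it unchanged.\<close>

definition window_sum :: "nat \<Rightarrow> (nat \<Rightarrow> real) \<Rightarrow> nat \<Rightarrow> nat \<Rightarrow> real" where
  "window_sum K x r k = (\<Sum>j\<in>{k..min (k + r) K}. x j)"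

lemma window_sum_0: "k \<le> K \<Longrightarrow> window_sum K x 0 k = x k"
  by (simp add: window_sum_def)

text \<open>The window is split at its first node, not its last, because the message that reaches
  node \<open>k\<close> is the window starting at \<open>Suc k\<close>. The store receives no such
  message, hence the 0.\<close>

lemma window_sum_Suc:
  assumes "k \<le> K"
  shows "window_sum K x (Suc r) k = x k + (if k < K then window_sum K x r (Suc k) else 0)"
proof (cases "k < K")
  case True
  then have "{k..min (k + Suc r) K} = insert k {Suc k..min (Suc k + r) K}"
    by auto
  with True show ?thesis
    by (simp add: window_sum_def)
next
  case False
  with assms show ?thesis
    by (simp add: window_sum_def)
qed

lemma rec_nbrs_serial_edges:
  "rec_nbrs (serial_edges K) k = (if k < K then {Suc k} else {})"
  by (auto simp: rec_nbrs_def serial_edges_def image_iff)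

text \<open>Zero padding makes the range of summation independent of the lead time, so one EmbedNode
  shared by all nodes can compute the inventory position. The bound \<open>m\<close> ensures that no
  outstanding order is cut off.\<close>

lemma inventory_position_conv_node_feature:
  assumes "1 \<le> k" "1 \<le> L k" "L k - 1 \<le> m"
  shows "(\<Sum>i\<in>{0..m}. node_feature m L s0 S I Q k $ i) = inventory_position L I Q k"
proof -
  have "(\<Sum>i\<in>{0..m}. node_feature m L s0 S I Q k $ i)
      = (\<Sum>i\<in>{0..m}. if i = 0 then I k else if i < L k then Q k i else 0)"
    using assms(1) by (intro sum.cong) (auto simp: node_feature_def)
  also have "\<dots> = I k + (\<Sum>i\<in>{1..m}. if i < L k then Q k i else 0)"
    by (simp add: sum.atLeast_Suc_atMost)
  also have "(\<Sum>i\<in>{1..m}. if i < L k then Q k i else 0) = (\<Sum>i\<in>{1..<L k}. Q k i)"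
    using assms by (intro sum.mono_neutral_cong_right) auto
  finally show ?thesis
    by (simp add: inventory_position_def)
qed

text \<open>For p > 0, multiplying p into \<open>min 1 (I j / p)\<close> gives
  \<open>min (I j) p\<close>; for p = 0 both sides vanish because \<open>I j\<close> is
  nonnegative.\<close>

lemma proportional_allocation_single_receiver:
  assumes "rec_nbrs E j = {k}" "0 \<le> I j"
  shows "proportional_allocation E I b j k = min (I j) (pos_part (b (j, k)))"
proof (cases "pos_part (b (j, k)) = 0")
  case True
  with assms(2) show ?thesis
    by (simp add: proportional_allocation_def)
next
  case False
  then have pos: "0 < pos_part (b (j, k))"
    by (simp add: pos_part_def split: if_splits)
  then have "p * min 1 (I j / p) = min (I j) p" if "p = pos_part (b (j, k))" for p
    using that by (auto simp: min_def field_simps)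
  with False assms(1) show ?thesis
    by (simp add: proportional_allocation_def)
qed

lemma vec_of_list_add2:
  "vec_of_list [a, b] + vec_of_list [c, d] = vec_of_list [a + c, b + d :: real]"
  by (rule eq_vecI) (auto simp: vec_of_list_index less_Suc_eq)

lemma vec_of_list_add3:
  "vec_of_list [a, b, c] + vec_of_list [a', b', c'] = vec_of_list [a + a', b + b', c + c' :: real]"
  by (rule eq_vecI) (auto simp: vec_of_list_index less_Suc_eq)

text \<open>Node embeddings are \<open>(inventory position, window sum, base-stock level)\<close> and edge
  embeddings are \<open>(window sum, base-stock level)\<close> of the receiving node. Updates are added to
  the old embedding, so each subtracts the value that it replaces.\<close>

definition echelon_gnn :: "nat \<Rightarrow> gnn" where
  "echelon_gnn m = \<lparr>
     node_dim = 3,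
     edge_dim = 2,
     embed_node = (\<lambda>s. vec_of_list [(\<Sum>i\<in>{0..m}. s $ i), (\<Sum>i\<in>{0..m}. s $ i), s $ (m + 1)]),
     embed_edge = (\<lambda>x y l. vec_of_list [y $ 1, y $ 2]),
     update_node = (\<lambda>x u v. vec_of_list [0, x $ 0 + v $ 0 - x $ 1, 0]),
     update_edge = (\<lambda>u x y. vec_of_list [y $ 1 - u $ 0, 0]),
     readout = (\<lambda>u. pos_part (u $ 1 - u $ 0))\<rparr>"

lemma is_gnn_echelon_gnn: "is_gnn d (echelon_gnn m)"
proof -
  have "vec_of_list [a, b] \<in> carrier_vec 2" "vec_of_list [a, b, c] \<in> carrier_vec 3"
    for a b c :: real
    by (rule carrier_vecI, simp)+
  then show ?thesis
    by (simp add: is_gnn_def echelon_gnn_def del: vec_of_list_Cons)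
qed

text \<open>Invariant of message passing. The induction on \<open>r\<close> keeps \<open>k\<close>
  arbitrary, since the next round at node \<open>k\<close> reads the current window of edge
  \<open>(k, Suc k)\<close>.\<close>

lemma echelon_gnn_rounds:
  fixes m L s0 S I Q lead
  defines "feat \<equiv> node_feature m L s0 S I Q" and "x \<equiv> inventory_position L I Q"
  assumes L: "\<And>k. k \<in> {1..K} \<Longrightarrow> 1 \<le> L k \<and> L k - 1 \<le> m"
    and k: "1 \<le> k" "k \<le> K"
  shows "fst ((gnn_round (echelon_gnn m) (serial_edges K) ^^ r)
            (gnn_init (echelon_gnn m) feat lead)) k
          = vec_of_list [x k, window_sum K x r k, S k] \<and>
         snd ((gnn_round (echelon_gnn m) (serial_edges K) ^^ r)
            (gnn_init (echelon_gnn m) feat lead)) (k - 1, k)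
          = vec_of_list [window_sum K x r k, S k]"
  using k
proof (induction r arbitrary: k)
  case 0
  have "(\<Sum>i\<in>{0..m}. feat k $ i) = x k"
    unfolding feat_def x_def
    using 0 L[of k] by (intro inventory_position_conv_node_feature) auto
  moreover have "feat k $ (m + 1) = S k"
    using 0 by (simp add: feat_def node_feature_def)
  ultimately show ?case
    using 0 by (simp add: gnn_init_def echelon_gnn_def Let_def window_sum_0 vec_of_list_index
        del: vec_of_list_Cons)
next
  case (Suc r)
  obtain hn he where p: "(gnn_round (echelon_gnn m) (serial_edges K) ^^ r)
      (gnn_init (echelon_gnn m) feat lead) = (hn, he)"
    by fastforce
  have hn: "hn k = vec_of_list [x k, window_sum K x r k, S k]"
    and he: "he (k - 1, k) = vec_of_list [window_sum K x r k, S k]"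
    using Suc.IH[of k] Suc.prems p by auto
  have "he (k, Suc k) $ 0 = window_sum K x r (Suc k)" if "k < K"
    using Suc.IH[of "Suc k"] that p by simp
  \<comment> \<open>With a single receiver the normalisation divides by sqrt 1; at the store the
    empty sum gives 0 / 0 = 0.\<close>
  then have "z_out (echelon_gnn m) (serial_edges K) he k $ 0
      = (if k < K then window_sum K x r (Suc k) else 0)"
    by (simp add: z_out_def rec_nbrs_serial_edges echelon_gnn_def)
  then have node: "hn k + update_node (echelon_gnn m) (hn k) u
        (z_out (echelon_gnn m) (serial_edges K) he k)
      = vec_of_list [x k, window_sum K x (Suc r) k, S k]" for u
    unfolding hn using Suc.prems
    by (simp add: echelon_gnn_def vec_of_list_add3 vec_of_list_index window_sum_Suc
        del: vec_of_list_Cons)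
  \<comment> \<open>The edge sees the node embedding already updated in this round, so its window
    does not lag one round behind.\<close>
  have edge: "he (k - 1, k) + update_edge (echelon_gnn m) (he (k - 1, k)) v
        (vec_of_list [x k, window_sum K x (Suc r) k, S k])
      = vec_of_list [window_sum K x (Suc r) k, S k]" for v
    unfolding he
    by (simp add: echelon_gnn_def vec_of_list_add2 vec_of_list_index del: vec_of_list_Cons)
  have "(gnn_round (echelon_gnn m) (serial_edges K) ^^ Suc r)
      (gnn_init (echelon_gnn m) feat lead) = gnn_round (echelon_gnn m) (serial_edges K) (hn, he)"
    by (simp add: p)
  then show ?case
    using Suc.prems node edge by (simp add: gnn_round_def Let_def del: vec_of_list_Cons funpow.simps)
qed

lemma echelon_gnn_readout:
  assumes "\<And>k. k \<in> {1..K} \<Longrightarrow> 1 \<le> L k \<and> L k - 1 \<le> m"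
    and "1 \<le> k" "k \<le> K"
  shows "gnn_readout (echelon_gnn m) (serial_edges K) (K - 1) (node_feature m L s0 S I Q) lead
           (k - 1, k)
         = pos_part (S k - echelon_position K L I Q k)"
proof -
  \<comment> \<open>The case k = 1 is tight: the window from node 1 reaches the store only after all
    K - 1 rounds.\<close>
  have "min (k + (K - 1)) K = K"
    using assms(2,3) by linarith
  then have "window_sum K (inventory_position L I Q) (K - 1) k = echelon_position K L I Q k"
    by (simp add: window_sum_def echelon_position_def)
  moreover have "readout (echelon_gnn m) (vec_of_list [y, s]) = pos_part (s - y)" for y s
    by (simp add: echelon_gnn_def vec_of_list_index del: vec_of_list_Cons)
  ultimately show ?thesis
    using echelon_gnn_rounds[OF assms] by (simp add: gnn_readout_def)
qed

theorem mainTheorem3: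
  fixes K m :: nat and L :: "nat \<Rightarrow> nat" and S :: "nat \<Rightarrow> real" and s0 :: "real vec"
  assumes "1 \<le> K"
    and "\<And>k. k \<in> {1..K} \<Longrightarrow> 1 \<le> L k \<and> L k - 1 \<le> m"
    and "s0 \<in> carrier_vec (m + 2)"
  shows "\<exists>G :: gnn. is_gnn (m + 2) G \<and>
    (\<forall>I Q. network_state K L I Q \<longrightarrow>
       (\<forall>k\<in>{1..K}.
          gnn_allocation G (serial_edges K) (K - 1) (node_feature m L s0 S I Q)
            (\<lambda>(j, k). real (L k)) I (k - 1) k
          = echelon_stock_policy K L S I Q k))"
proof (intro exI[of _ "echelon_gnn m"] conjI allI impI ballI is_gnn_echelon_gnn)
  fix I Q k
  assume state: "network_state K L I Q" and k: "k \<in> {1..K}"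
  let ?b = "gnn_readout (echelon_gnn m) (serial_edges K) (K - 1) (node_feature m L s0 S I Q)
    (\<lambda>(j, k). real (L k))"
  have b: "?b (k - 1, k) = pos_part (S k - echelon_position K L I Q k)"
    using k by (intro echelon_gnn_readout assms(2)) auto
  show "gnn_allocation (echelon_gnn m) (serial_edges K) (K - 1) (node_feature m L s0 S I Q)
      (\<lambda>(j, k). real (L k)) I (k - 1) k = echelon_stock_policy K L S I Q k"
  proof (cases "k = 1")
    \<comment> \<open>Node 0 passes on the readout unrationed, so the positive part has to come from
      the readout itself.\<close>
    case True
    with b show ?thesis
      by (simp add: gnn_allocation_def echelon_stock_policy_def)
  next
    case False
    with k have "k - 1 \<in> {1..<K}" "rec_nbrs (serial_edges K) (k - 1) = {k}"
      by (auto simp: rec_nbrs_serial_edges)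
    moreover from this state have "0 \<le> I (k - 1)"
      by (simp add: network_state_def)
    ultimately have "proportional_allocation (serial_edges K) I ?b (k - 1) k
        = min (I (k - 1)) (pos_part (?b (k - 1, k)))"
      by (intro proportional_allocation_single_receiver)
    \<comment> \<open>The readout is already nonnegative, so the positive part taken by the
      allocation rule does not change it.\<close>
    with False k b show ?thesis
      by (simp add: gnn_allocation_def echelon_stock_policy_def Let_def pos_part_def)
  qed
qed

end
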